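(* Let $G$ be a connected nontrivial graph with $\Delta(G)\le 2$. Then $$\chi''_a(S(G))=\begin{cases}3 & \text{if } G\cong P_2,\\ 4 & \text{otherwise,}\end{cases}$$ where $S(G)$ is the subdivision graph of $G$.
   Context: All graphs are finite, undirected and simple; nontrivial means having at least two vertices. $\Delta(G)$ is the maximum degree of $G$, and $P_n$ is the path on $n$ vertices. A proper total coloring of a graph $G$ is a coloring of $V(G)\cup E(G)$ in which no two adjacent or incident elements receive the same color (adjacent vertices get different colors, edges sharing an endpoint get different colors, and each edge gets a color different from those of its endpoints). An adjacent vertex distinguishing (AVD) total coloring of $G$ is a proper total coloring $f$ such that $C_G(u)\ne C_G(v)$ for every edge $uv\in E(G)$, where $C_G(u)=\{f(u)\}\cup\{f(uw): uw\in E(G)\}$. The AVD-total chromatic number $\chi''_a(G)$ is the least number of colors in an AVD-total coloring of $G$. The subdivision graph $S(G)$ is obtained from $G$ by replacing each edge $xy\in E(G)$ with the two edges $xw_{xy}$ and $w_{xy}y$, where $w_{xy}$ is a new vertex. *)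

theory Defs
  imports "Graph_Theory.Graph_Theory"
begin

text \<open>
  A finite simple undirected graph is a \<^locale>\<open>pair_graph\<close>: a finite loop-free symmetric
  digraph whose arcs are ordered pairs. An undirected edge \<open>uv\<close> is thus represented by the two
  arcs \<open>(u, v)\<close> and \<open>(v, u)\<close>. Colourings must give an edge a single colour, so the
  undirected edges are recovered as two-element sets.
\<close>

definition uedges :: "'a pair_pre_digraph \<Rightarrow> 'a set set" where
  "uedges G = (\<lambda>(u, v). {u, v}) ` parcs G"

text \<open>By symmetry of the arc relation, the out-degree is the number of neighbours.\<close>

definition max_degree :: "'a pair_pre_digraph \<Rightarrow> nat" where
  "max_degree G = Max (out_degree (with_proj G) ` pverts G)"

definition path_graph :: "nat \<Rightarrow> nat pair_pre_digraph" where
  "path_graph n = \<lparr> pverts = {..<n},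
     parcs = {(i, j). i < n \<and> j < n \<and> (j = Suc i \<or> i = Suc j)} \<rparr>"

text \<open>
  Old vertices are tagged with \<^const>\<open>Inl\<close>; the new vertex subdividing the edge \<open>e\<close> is
  \<open>Inr e\<close>.
\<close>

definition subdivision_graph :: "'a pair_pre_digraph \<Rightarrow> ('a + 'a set) pair_pre_digraph" where
  "subdivision_graph G = \<lparr>
     pverts = Inl ` pverts G \<union> Inr ` uedges G,
     parcs = {(Inl x, Inr e) | x e. e \<in> uedges G \<and> x \<in> e}
           \<union> {(Inr e, Inl x) | x e. e \<in> uedges G \<and> x \<in> e} \<rparr>"

text \<open>
  The elements of a graph coloured by a total colouring: \<open>Inl v\<close> is the vertex \<open>v\<close>, and
  \<open>Inr e\<close> is the edge \<open>e\<close>.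
\<close>

definition total_elements :: "'a pair_pre_digraph \<Rightarrow> ('a + 'a set) set" where
  "total_elements G = Inl ` pverts G \<union> Inr ` uedges G"

definition proper_total_coloring :: "'a pair_pre_digraph \<Rightarrow> ('a + 'a set \<Rightarrow> 'c) \<Rightarrow> bool" where
  "proper_total_coloring G f \<longleftrightarrow>
     (\<forall>(u, v) \<in> parcs G. f (Inl u) \<noteq> f (Inl v)) \<and>
     (\<forall>e \<in> uedges G. \<forall>e' \<in> uedges G. e \<noteq> e' \<and> e \<inter> e' \<noteq> {} \<longrightarrow> f (Inr e) \<noteq> f (Inr e')) \<and>
     (\<forall>e \<in> uedges G. \<forall>v \<in> e. f (Inl v) \<noteq> f (Inr e))"

definition color_set :: "'a pair_pre_digraph \<Rightarrow> ('a + 'a set \<Rightarrow> 'c) \<Rightarrow> 'a \<Rightarrow> 'c set" where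
  "color_set G f u = {f (Inl u)} \<union> {f (Inr {u, w}) | w. (u, w) \<in> parcs G}"

definition avd_total_coloring :: "'a pair_pre_digraph \<Rightarrow> ('a + 'a set \<Rightarrow> 'c) \<Rightarrow> bool" where
  "avd_total_coloring G f \<longleftrightarrow>
     proper_total_coloring G f \<and> (\<forall>(u, v) \<in> parcs G. color_set G f u \<noteq> color_set G f v)"

text \<open>
  Natural numbers serve as colours, which is no restriction for finite graphs. Values of a colouring
  outside \<^const>\<open>total_elements\<close> are irrelevant and not counted. The minimum is over a
  nonempty set by \<open>ex_avd_total_coloring\<close> below.
\<close>

definition avd_total_chromatic_number :: "'a pair_pre_digraph \<Rightarrow> nat" where
  "avd_total_chromatic_number G =
     (LEAST k. \<exists>f :: 'a + 'a set \<Rightarrow> nat.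
        avd_total_coloring G f \<and> card (f ` total_elements G) = k)"

lemma pair_graph_path_graph: "pair_graph (path_graph n)"
proof -
  have "{(i, j). i < n \<and> j < n \<and> (j = Suc i \<or> i = Suc j)} \<subseteq> {..<n} \<times> {..<n}" by auto
  then have "finite {(i, j). i < n \<and> j < n \<and> (j = Suc i \<or> i = Suc j)}"
    by (rule finite_subset) simp
  then show ?thesis
    by unfold_locales (auto simp: path_graph_def symmetric_def sym_def)
qed

lemma (in pair_graph) finite_uedges: "finite (uedges G)"
  by (simp add: uedges_def pair_finite_arcs)

lemma (in pair_graph) uedges_subset: "e \<in> uedges G \<Longrightarrow> e \<subseteq> pverts G"
  by (auto simp: uedges_def dest: in_arcsD1 in_arcsD2)

lemma (in pair_graph) pair_graph_subdivision_graph: "pair_graph (subdivision_graph G)"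
proof -
  have "parcs (subdivision_graph G)
      \<subseteq> pverts (subdivision_graph G) \<times> pverts (subdivision_graph G)"
    using uedges_subset by (fastforce simp: subdivision_graph_def)
  moreover have "finite (pverts (subdivision_graph G))"
    by (simp add: subdivision_graph_def finite_uedges pair_finite_verts)
  ultimately have "finite (parcs (subdivision_graph G))"
    by (meson finite_SigmaI finite_subset)
  moreover note \<open>finite (pverts (subdivision_graph G))\<close>
  moreover have "x \<in> pverts G" if "e \<in> uedges G" "x \<in> e" for x e
    using that uedges_subset by blast
  ultimately show ?thesis
    by unfold_locales (auto simp: subdivision_graph_def symmetric_def sym_def)
qed

text \<open>A colouring with pairwise distinct colours is AVD: the colour of \<open>u\<close> is missing at \<open>v\<close>.\<close>

lemma (in pair_graph) ex_avd_total_coloring: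
  "\<exists>f :: 'a + 'a set \<Rightarrow> nat. avd_total_coloring G f"
proof -
  have "finite (total_elements G)"
    by (simp add: total_elements_def finite_uedges pair_finite_verts)
  then obtain f :: "'a + 'a set \<Rightarrow> nat" where f: "inj_on f (total_elements G)"
    using finite_imp_inj_to_nat_seg by blast
  have V: "Inl v \<in> total_elements G" if "v \<in> pverts G" for v
    using that by (simp add: total_elements_def)
  have E: "Inr e \<in> total_elements G" if "e \<in> uedges G" for e
    using that by (simp add: total_elements_def)
  have ne: "f x \<noteq> f y" if "x \<in> total_elements G" "y \<in> total_elements G" "x \<noteq> y" for x y
    using f that by (meson inj_onD)
  have arc: "u \<in> pverts G \<and> v \<in> pverts G \<and> u \<noteq> v \<and> {u, v} \<in> uedges G"
    if "(u, v) \<in> parcs G" for u v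
    using that pair_no_loops[OF that] by (force simp: uedges_def dest: in_arcsD1 in_arcsD2)
  have "proper_total_coloring G f"
    unfolding proper_total_coloring_def
  proof (intro conjI ballI impI)
    fix p assume "p \<in> parcs G"
    then show "case p of (u, v) \<Rightarrow> f (Inl u) \<noteq> f (Inl v)"
      using arc ne V by (cases p) blast
  next
    fix e e' assume "e \<in> uedges G" "e' \<in> uedges G" "e \<noteq> e' \<and> e \<inter> e' \<noteq> {}"
    then show "f (Inr e) \<noteq> f (Inr e')" using ne E by blast
  next
    fix e v assume "e \<in> uedges G" "v \<in> e"
    then show "f (Inl v) \<noteq> f (Inr e)" using ne E V uedges_subset by blast
  qed
  moreover have "color_set G f u \<noteq> color_set G f v" if uv: "(u, v) \<in> parcs G" for u v
  proof -
    have "f (Inl u) \<notin> color_set G f v"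
      using arc[OF uv] arc ne V E unfolding color_set_def by blast
    then show ?thesis by (auto simp: color_set_def)
  qed
  ultimately show ?thesis unfolding avd_total_coloring_def by blast
qed

end

(* In S(G), give all old vertices one colour and all new vertices a second one. If the edges of S(G)
   can be properly coloured with two further colours, then the result is an AVD-total colouring,
   because the colour of a vertex never occurs at its neighbours. Such an edge colouring is the same
   as an orientation of G with all in- and out-degrees at most 1, in which the half-edge at the head
   of an edge gets one colour and the half-edge at its tail the other. For maximum degree 2 the
   orientation is built edge by edge, reversing a component where necessary.

   Conversely, two adjacent vertices of degree 2 carry distinct sets of three colours each. Unless
   G is P_2, it has a vertex of degree 2, whose neighbours in S(G) also have degree 2. *)

theory Submission
  imports Defs
begin

section \<open>Orientations with in- and out-degrees at most 1\<close>

text \<open>\<open>asym\<close> keeps just one direction of each edge in \<open>E\<close>.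
  Single-valuedness of \<open>R\<close> bounds out-degrees by 1, that of the converse bounds
  in-degrees by 1.\<close>

definition orients :: "'a rel \<Rightarrow> 'a set set \<Rightarrow> bool" where
  "orients R E \<longleftrightarrow> (\<lambda>(u, v). {u, v}) ` R = E \<and> asym R \<and> single_valued R \<and> single_valued (R\<inverse>)"

lemma orients_converse: "orients R E \<Longrightarrow> orients (R\<inverse>) E"
proof -
  have "(\<lambda>(u, v). {u, v}) ` (R\<inverse>) = (\<lambda>(u, v). {u, v}) ` R"
    unfolding converse_unfold image_def by (auto simp: insert_commute)
  then show "orients R E \<Longrightarrow> orients (R\<inverse>) E"
    unfolding orients_def by (auto simp: asym_on_def)
qed

text \<open>Both \<open>u\<close> and \<open>v\<close> are sinks. Since out-degrees are at most 1,
  the vertices from which \<open>u\<close> can be reached form a whole component, and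
  \<open>v\<close> lies outside it. Reversing that component makes \<open>u\<close> a source and
  leaves \<open>v\<close> a sink.\<close>

lemma orients_flip:
  assumes R: "orients R E" and u: "u \<notin> Domain R" and v: "v \<notin> Domain R" and "u \<noteq> v"
  obtains R' where "orients R' E" "u \<notin> Range R'" "v \<notin> Domain R'"
proof -
  define A where "A = {z. (z, u) \<in> R\<^sup>*}"
  define R' where "R' = {(a, b) \<in> R. a \<notin> A} \<union> {(b, a) | a b. (a, b) \<in> R \<and> a \<in> A}"
  have img: "(\<lambda>(u, v). {u, v}) ` R = E" and asym: "\<And>a b. (a, b) \<in> R \<Longrightarrow> (b, a) \<notin> R"
    and out: "\<And>a b c. (a, b) \<in> R \<Longrightarrow> (a, c) \<in> R \<Longrightarrow> b = c"
    and "in": "\<And>a b c. (b, a) \<in> R \<Longrightarrow> (c, a) \<in> R \<Longrightarrow> b = c"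
    using R unfolding orients_def single_valued_def asym_on_def by blast+
  \<comment> \<open>From left to right: \<open>a\<close> is not the sink \<open>u\<close>, and its
    only outgoing arc leads to \<open>b\<close>, so the path from \<open>a\<close> to
    \<open>u\<close> passes through \<open>b\<close>.\<close>
  have closed: "a \<in> A \<longleftrightarrow> b \<in> A" if "(a, b) \<in> R" for a b
  proof
    assume "a \<in> A"
    then have "(a, u) \<in> R\<^sup>*" by (simp add: A_def)
    then show "b \<in> A"
      using that u out by (cases rule: converse_rtranclE) (auto simp: A_def)
  next
    assume "b \<in> A"
    then show "a \<in> A" using that by (auto simp: A_def intro: converse_rtrancl_into_rtrancl)
  qed
  have "u \<in> A" by (simp add: A_def)
  have "v \<notin> A"
  proof
    assume "v \<in> A"
    then have "(v, u) \<in> R\<^sup>*" by (simp add: A_def)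
    then show False using v \<open>u \<noteq> v\<close> by (cases rule: converse_rtranclE) auto
  qed
  have "(\<lambda>(u, v). {u, v}) ` R' = E"
  proof -
    have "{a, b} \<in> (\<lambda>(u, v). {u, v}) ` R'" if "(a, b) \<in> R" for a b
      using that unfolding R'_def by (cases "a \<in> A") (force simp: insert_commute)+
    moreover have "{a, b} \<in> (\<lambda>(u, v). {u, v}) ` R" if "(a, b) \<in> R'" for a b
      using that unfolding R'_def by (force simp: insert_commute)
    ultimately show ?thesis unfolding img[symmetric] by auto
  qed
  moreover have "asym R'" unfolding asym_on_def R'_def using asym closed by blast
  \<comment> \<open>Inside \<open>A\<close> the in- and out-bounds of \<open>R\<close> trade places,
    outside they stay as they are. By \<open>closed\<close>, a reversed arc and a kept arc never
    share a vertex.\<close>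
  moreover have "single_valued R'" unfolding single_valued_def R'_def using out "in" closed by blast
  moreover have "single_valued (R'\<inverse>)"
    unfolding single_valued_def R'_def using out "in" closed by blast
  ultimately have "orients R' E" by (simp add: orients_def)
  moreover have "u \<notin> Range R'" using u \<open>u \<in> A\<close> closed unfolding R'_def by blast
  moreover have "v \<notin> Domain R'" using v \<open>v \<notin> A\<close> closed unfolding R'_def by blast
  ultimately show ?thesis by (rule that)
qed

text \<open>Asymmetry could only fail through the arc \<open>(v, u)\<close>, whose edge would
  already be in \<open>E\<close>. The conditions on \<open>u\<close> and \<open>v\<close> keep both
  degree bounds.\<close>

lemma orients_insert:
  assumes R: "orients R E" and new: "{u, v} \<notin> E" and "u \<noteq> v" "u \<notin> Domain R" "v \<notin> Range R"
  shows "orients (insert (u, v) R) (insert {u, v} E)"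
proof -
  have "(v, u) \<notin> R" using R new unfolding orients_def by (force simp: insert_commute)
  then show ?thesis
    using assms unfolding orients_def asym_on_def single_valued_def by auto
qed

text \<open>Otherwise an outgoing arc, an incoming arc and \<open>e\<close> give three edges at
  \<open>x\<close>. Asymmetry makes the two arcs different edges.\<close>

lemma degree_le_2_Domain_or_Range:
  assumes R: "orients R E" and "e \<notin> E" "x \<in> e" "finite E"
    and deg: "card {d \<in> insert e E. x \<in> d} \<le> 2"
  shows "x \<notin> Domain R \<or> x \<notin> Range R"
proof (rule ccontr)
  assume "\<not> ?thesis"
  then obtain y z where y: "(x, y) \<in> R" and z: "(z, x) \<in> R" by blast
  have "y \<noteq> z" using R y z unfolding orients_def asym_on_def by blast
  then have ne: "{x, y} \<noteq> {z, x}" by (auto simp: doubleton_eq_iff)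
  have E: "{x, y} \<in> E" "{z, x} \<in> E" using R y z unfolding orients_def by force+
  have "{e, {x, y}, {z, x}} \<subseteq> {d \<in> insert e E. x \<in> d}" using E \<open>x \<in> e\<close> by auto
  then have "card {e, {x, y}, {z, x}} \<le> card {d \<in> insert e E. x \<in> d}"
    using \<open>finite E\<close> by (intro card_mono) auto
  moreover have "e \<noteq> {x, y}" "e \<noteq> {z, x}" using E \<open>e \<notin> E\<close> by auto
  then have "card {e, {x, y}, {z, x}} = 3" using ne by simp
  ultimately show False using deg by simp
qed

text \<open>Edges are added one at a time. Before \<open>e\<close> is added, each of its ends lacks
  an outgoing or an incoming arc. If one end lacks an outgoing arc and the other an incoming one,
  \<open>e\<close> can be directed at once; otherwise a reversal comes first.\<close>

lemma ex_orientation: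
  assumes "finite E" "\<And>e. e \<in> E \<Longrightarrow> card e = 2" "\<And>x. card {e \<in> E. x \<in> e} \<le> 2"
  shows "\<exists>R. orients R E"
  using assms
proof (induction E rule: finite_induct)
  case empty
  have "orients {} {}" by (simp add: orients_def asym_on_def single_valued_def)
  then show ?case by blast
next
  case (insert e E)
  have "card {d \<in> E. x \<in> d} \<le> 2" for x
  proof -
    have "card {d \<in> E. x \<in> d} \<le> card {d \<in> insert e E. x \<in> d}"
      using insert.hyps by (intro card_mono) auto
    then show ?thesis using insert.prems(2)[of x] by linarith
  qed
  then obtain R where R: "orients R E" using insert.IH insert.prems(1) by blast
  obtain u v where e: "e = {u, v}" and "u \<noteq> v"
    using insert.prems(1)[of e] by (auto simp: card_2_iff)
  have new: "{u, v} \<notin> E" "{v, u} \<notin> E" using insert.hyps e by (auto simp: insert_commute)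
  have u: "u \<notin> Domain R \<or> u \<notin> Range R" and v: "v \<notin> Domain R \<or> v \<notin> Range R"
    using degree_le_2_Domain_or_Range[OF R insert.hyps(2) _ insert.hyps(1) insert.prems(2)] e
    by auto
  \<comment> \<open>Two sinks: \<open>orients_flip\<close> turns \<open>u\<close> into a source, so
    the new edge can be directed from \<open>v\<close> to \<open>u\<close>. Two sources are reduced
    to this case by reversing all of \<open>R\<close>.\<close>
  have main: "\<exists>R. orients R (insert {u, v} E)"
    if R: "orients R E" "u \<notin> Domain R" "v \<notin> Domain R" for R
  proof -
    obtain R' where "orients R' E" "u \<notin> Range R'" "v \<notin> Domain R'"
      using orients_flip[OF R \<open>u \<noteq> v\<close>] .
    then show ?thesis
      using orients_insert[of R' E v u] new \<open>u \<noteq> v\<close> by (auto simp: insert_commute)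
  qed
  consider "u \<notin> Domain R" "v \<notin> Range R" | "v \<notin> Domain R" "u \<notin> Range R"
    | "u \<notin> Domain R" "v \<notin> Domain R" | "u \<notin> Range R" "v \<notin> Range R"
    using u v by blast
  then show ?case
  proof cases
    case 1
    then show ?thesis using orients_insert[OF R new(1) \<open>u \<noteq> v\<close>] e by blast
  next
    case 2
    then have "orients (insert (v, u) R) (insert {v, u} E)"
      using orients_insert[OF R new(2)] \<open>u \<noteq> v\<close> by blast
    then show ?thesis unfolding e by (auto simp: insert_commute)
  next
    case 3
    then show ?thesis using main[OF R] e by blast
  next
    case 4
    then show ?thesis using main[OF orients_converse[OF R]] e by auto
  qed
qed

section \<open>Colour sets and lower bounds on the number of colours\<close>

context pair_graph
begin

lemma arc_uedge: "(u, v) \<in> parcs G \<Longrightarrow> {u, v} \<in> uedges G"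
  by (force simp: uedges_def)

lemma uedgeE:
  assumes "e \<in> uedges G"
  obtains u v where "e = {u, v}" "u \<noteq> v" "(u, v) \<in> parcs G" "(v, u) \<in> parcs G"
proof -
  obtain u v where uv: "(u, v) \<in> parcs G" and "e = {u, v}" using assms by (auto simp: uedges_def)
  then show ?thesis using that[of u v] pair_no_loops[OF uv] arcs_symmetric[OF uv] by simp
qed

lemma finite_total_elements: "finite (total_elements G)"
  by (simp add: total_elements_def finite_uedges pair_finite_verts)

lemma color_set_subset: "u \<in> pverts G \<Longrightarrow> color_set G f u \<subseteq> f ` total_elements G"
  unfolding color_set_def total_elements_def using arc_uedge by auto

lemma finite_color_set: "u \<in> pverts G \<Longrightarrow> finite (color_set G f u)"
  using color_set_subset finite_total_elements by (meson finite_imageI finite_subset)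

lemma card_color_set_ge_3:
  assumes f: "proper_total_coloring G f" and uv: "(u, v) \<in> parcs G" and uw: "(u, w) \<in> parcs G"
    and "v \<noteq> w"
  shows "3 \<le> card (color_set G f u)"
proof -
  have "{u, v} \<noteq> {u, w} \<and> {u, v} \<inter> {u, w} \<noteq> {}"
    using \<open>v \<noteq> w\<close> by (simp add: doubleton_eq_iff)
  moreover have E: "\<forall>e \<in> uedges G. \<forall>e' \<in> uedges G. e \<noteq> e' \<and> e \<inter> e' \<noteq> {} \<longrightarrow> f (Inr e) \<noteq> f (Inr e')"
    and V: "\<forall>e \<in> uedges G. \<forall>v \<in> e. f (Inl v) \<noteq> f (Inr e)"
    using f by (simp_all add: proper_total_coloring_def)
  ultimately have "f (Inr {u, v}) \<noteq> f (Inr {u, w})"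
    using arc_uedge[OF uv] arc_uedge[OF uw] by metis
  moreover have "f (Inl u) \<noteq> f (Inr {u, v})" "f (Inl u) \<noteq> f (Inr {u, w})"
    using V arc_uedge[OF uv] arc_uedge[OF uw] by auto
  ultimately have "card {f (Inl u), f (Inr {u, v}), f (Inr {u, w})} = 3" by simp
  moreover have "{f (Inl u), f (Inr {u, v}), f (Inr {u, w})} \<subseteq> color_set G f u"
    using uv uw unfolding color_set_def by blast
  ultimately show ?thesis
    using card_mono[OF finite_color_set] in_arcsD1[OF uv] by metis
qed

lemma card_colors_ge_3:
  assumes "proper_total_coloring G f" "(u, v) \<in> parcs G" "(u, w) \<in> parcs G" "v \<noteq> w"
  shows "3 \<le> card (f ` total_elements G)"
  using card_color_set_ge_3[OF assms] color_set_subset[of u f] in_arcsD1[OF assms(2)]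
    card_mono[OF finite_imageI[OF finite_total_elements], of "color_set G f u" f]
  by linarith

text \<open>With at most three colours in use, the colour sets of \<open>u\<close> and
  \<open>v\<close>, having at least three elements each, would both be the set of all
  colours.\<close>

lemma card_colors_ge_4:
  assumes f: "avd_total_coloring G f" and uv: "(u, v) \<in> parcs G"
    and uw: "(u, w) \<in> parcs G" "w \<noteq> v" and vx: "(v, x) \<in> parcs G" "x \<noteq> u"
  shows "4 \<le> card (f ` total_elements G)"
proof (rule ccontr)
  assume "\<not> ?thesis"
  then have le: "card (f ` total_elements G) \<le> 3" by simp
  have proper: "proper_total_coloring G f" using f by (simp add: avd_total_coloring_def)
  have vu: "(v, u) \<in> parcs G" using uv arcs_symmetric by blast
  have "color_set G f z = f ` total_elements G"
    if "(z, y) \<in> parcs G" "(z, y') \<in> parcs G" "y \<noteq> y'" for z y y'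
    using card_color_set_ge_3[OF proper that] color_set_subset[of z f] in_arcsD1[OF that(1)] le
    by (intro card_seteq finite_imageI finite_total_elements) auto
  from this[OF uv uw(1)] this[OF vu vx(1)] have "color_set G f u = color_set G f v"
    using uw vx by auto
  then show False using f uv unfolding avd_total_coloring_def by blast
qed

lemma avd_total_chromatic_number_eqI:
  fixes f :: "'a + 'a set \<Rightarrow> nat"
  assumes "avd_total_coloring G f" "card (f ` total_elements G) \<le> k"
    and "\<And>f :: 'a + 'a set \<Rightarrow> nat. avd_total_coloring G f \<Longrightarrow> k \<le> card (f ` total_elements G)"
  shows "avd_total_chromatic_number G = k"
  unfolding avd_total_chromatic_number_def
proof (rule Least_equality)
  show "\<exists>f :: 'a + 'a set \<Rightarrow> nat. avd_total_coloring G f \<and> card (f ` total_elements G) = k"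
    using assms by (meson le_antisym)
qed (use assms in blast)

section \<open>Edges of the subdivision graph and degrees in \<open>G\<close>\<close>

lemma subdivision_graph_arcs:
  assumes "e \<in> uedges G" "x \<in> e"
  shows "(Inl x, Inr e) \<in> parcs (subdivision_graph G)"
    and "(Inr e, Inl x) \<in> parcs (subdivision_graph G)"
  using assms by (simp_all add: subdivision_graph_def)

lemma uedges_subdivision_graph:
  "uedges (subdivision_graph G) = {{Inl x, Inr e} | x e. e \<in> uedges G \<and> x \<in> e}"
proof -
  have "{Inl x, Inr e} \<in> uedges (subdivision_graph G)" if "e \<in> uedges G" "x \<in> e" for x e
    using subdivision_graph_arcs(1)[OF that] unfolding uedges_def by force
  then show ?thesis by (auto simp: uedges_def subdivision_graph_def insert_commute)
qed

text \<open>Links the count of incident edges in \<open>ex_orientation\<close> to the count of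
  neighbours that \<open>max_degree\<close> bounds.\<close>

lemma card_uedges_at: "card {e \<in> uedges G. x \<in> e} = card {y. (x, y) \<in> parcs G}"
proof -
  have "{e \<in> uedges G. x \<in> e} = (\<lambda>y. {x, y}) ` {y. (x, y) \<in> parcs G}"
    using arc_uedge by (auto elim!: uedgeE)
  moreover have "inj_on (\<lambda>y. {x, y}) {y. (x, y) \<in> parcs G}"
    by (auto simp: inj_on_def doubleton_eq_iff)
  ultimately show ?thesis by (simp add: card_image)
qed

lemma out_degree_eq_card_neighbours:
  "out_degree (with_proj G) x = card {y. (x, y) \<in> parcs G}"
proof -
  have "out_arcs (with_proj G) x = Pair x ` {y. (x, y) \<in> parcs G}" by auto
  then show ?thesis by (simp add: out_degree_def card_image inj_on_def)
qed

lemma card_neighbours_le_max_degree: "card {y. (x, y) \<in> parcs G} \<le> max_degree G"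
proof (cases "x \<in> pverts G")
  case True
  then show ?thesis
    unfolding max_degree_def out_degree_eq_card_neighbours[symmetric]
    by (intro Max_ge) (auto simp: pair_finite_verts)
next
  \<comment> \<open>The bound is wanted for every \<open>x\<close>, as in
    \<open>ex_orientation\<close>; outside the vertex set there are no neighbours.\<close>
  case False
  then have "{y. (x, y) \<in> parcs G} = {}" by (auto dest: in_arcsD1)
  then show ?thesis by simp
qed

section \<open>Colourings of the subdivision graph\<close>

text \<open>Old vertices get 0 and new vertices 1. For an arc \<open>(y, x)\<close> of
  \<open>R\<close>, the half-edge at the head \<open>x\<close> gets 2. The default 3 thus falls on
  the half-edges at tails when \<open>R\<close> orients \<open>G\<close>.\<close>

definition subdivision_coloring ::
  "'a rel \<Rightarrow> ('a + 'a set) + ('a + 'a set) set \<Rightarrow> nat" where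
  "subdivision_coloring R = case_sum (case_sum (\<lambda>_. 0) (\<lambda>_. 1))
     (\<lambda>s. if \<exists>(y, x) \<in> R. s = {Inl x, Inr {y, x}} then 2 else 3)"

lemma avd_subdivision_coloring:
  assumes R: "orients R (uedges G)"
  shows "avd_total_coloring (subdivision_graph G) (subdivision_coloring R)"
proof -
  let ?f = "subdivision_coloring R"
  have f_old: "?f (Inl (Inl x)) = 0" and f_new: "?f (Inl (Inr e)) = 1"
    and f_edge: "?f (Inr s) = 2 \<or> ?f (Inr s) = 3" for x e s
    by (simp_all add: subdivision_coloring_def)
  have head: "?f (Inr {Inl x, Inr e}) = 2 \<longleftrightarrow> (\<exists>y. (y, x) \<in> R \<and> e = {y, x})" for x e
    by (auto simp: subdivision_coloring_def doubleton_eq_iff)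
  \<comment> \<open>As 3 is the default value, it has to be known that \<open>e\<close> comes from
    an arc of \<open>R\<close>; \<open>x\<close> is an end of that arc but not its head.\<close>
  have tail: "?f (Inr {Inl x, Inr e}) = 3 \<Longrightarrow> \<exists>y. (x, y) \<in> R \<and> e = {x, y}"
    if "e \<in> uedges G" "x \<in> e" for x e
  proof -
    assume "?f (Inr {Inl x, Inr e}) = 3"
    then have "\<not> (\<exists>y. (y, x) \<in> R \<and> e = {y, x})" using head[of x e] by auto
    moreover have "e \<in> (\<lambda>(u, v). {u, v}) ` R" using R that(1) by (simp add: orients_def)
    then obtain a b where "(a, b) \<in> R" "e = {a, b}" by (elim imageE) (simp split: prod.splits)
    ultimately show ?thesis using \<open>x \<in> e\<close> by auto
  qed
  have asym: "\<And>a b. (a, b) \<in> R \<Longrightarrow> (b, a) \<notin> R"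
    and out: "\<And>a b c. (a, b) \<in> R \<Longrightarrow> (a, c) \<in> R \<Longrightarrow> b = c"
    and "in": "\<And>a b c. (b, a) \<in> R \<Longrightarrow> (c, a) \<in> R \<Longrightarrow> b = c"
    using R unfolding orients_def single_valued_def asym_on_def by blast+
  \<comment> \<open>Equal colours at an old vertex \<open>x\<close> would give two arcs of
    \<open>R\<close> into \<open>x\<close> or two out of it.\<close>
  have same_end: "?f (Inr {Inl x, Inr e}) \<noteq> ?f (Inr {Inl x, Inr e'})"
    if E: "e \<in> uedges G" "x \<in> e" "e' \<in> uedges G" "x \<in> e'" "e \<noteq> e'" for x e e'
  proof
    assume eq: "?f (Inr {Inl x, Inr e}) = ?f (Inr {Inl x, Inr e'})"
    show False
      using f_edge[of "{Inl x, Inr e}"]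
    proof
      assume "?f (Inr {Inl x, Inr e}) = 2"
      then obtain y y' where "(y, x) \<in> R" "e = {y, x}" "(y', x) \<in> R" "e' = {y', x}"
        using eq head[of x e] head[of x e'] by auto
      then show False using "in" \<open>e \<noteq> e'\<close> by blast
    next
      assume "?f (Inr {Inl x, Inr e}) = 3"
      then obtain y y' where "(x, y) \<in> R" "e = {x, y}" "(x, y') \<in> R" "e' = {x, y'}"
        using eq tail[of e x] tail[of e' x] E by auto
      then show False using out \<open>e \<noteq> e'\<close> by blast
    qed
  qed
  \<comment> \<open>Equal colours on both halves of \<open>e\<close> would put both directions of
    \<open>e\<close> into \<open>R\<close>.\<close>
  have same_edge: "?f (Inr {Inl x, Inr e}) \<noteq> ?f (Inr {Inl x', Inr e})"
    if E: "e \<in> uedges G" "x \<in> e" "x' \<in> e" "x \<noteq> x'" for x x' e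
  proof
    assume eq: "?f (Inr {Inl x, Inr e}) = ?f (Inr {Inl x', Inr e})"
    show False
      using f_edge[of "{Inl x, Inr e}"]
    proof
      assume "?f (Inr {Inl x, Inr e}) = 2"
      then obtain y y' where "(y, x) \<in> R" "e = {y, x}" "(y', x') \<in> R" "e = {y', x'}"
        using eq head[of x e] head[of x' e] by auto
      then show False using asym E by (auto simp: doubleton_eq_iff)
    next
      assume "?f (Inr {Inl x, Inr e}) = 3"
      then obtain y y' where "(x, y) \<in> R" "e = {x, y}" "(x', y') \<in> R" "e = {x', y'}"
        using eq tail[of e x] tail[of e x'] E by auto
      then show False using asym E by (auto simp: doubleton_eq_iff)
    qed
  qed
  have "proper_total_coloring (subdivision_graph G) ?f"
    unfolding proper_total_coloring_def
  proof (intro conjI ballI impI)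
    fix p assume "p \<in> parcs (subdivision_graph G)"
    then show "case p of (u, v) \<Rightarrow> ?f (Inl u) \<noteq> ?f (Inl v)"
      by (auto simp: subdivision_graph_def f_old f_new)
  next
    fix s t
    assume "s \<in> uedges (subdivision_graph G)" "t \<in> uedges (subdivision_graph G)"
      and st: "s \<noteq> t \<and> s \<inter> t \<noteq> {}"
    then obtain x e x' e' where s: "s = {Inl x, Inr e}" "e \<in> uedges G" "x \<in> e"
      and t: "t = {Inl x', Inr e'}" "e' \<in> uedges G" "x' \<in> e'"
      unfolding uedges_subdivision_graph by blast
    \<comment> \<open>Distinct edges of the subdivision graph that meet share either their old end
      or their new end, but not both.\<close>
    have "x = x' \<and> e \<noteq> e' \<or> x \<noteq> x' \<and> e = e'" using st s t by auto
    then show "?f (Inr s) \<noteq> ?f (Inr t)" using same_end same_edge s t by blast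
  next
    fix s v assume "s \<in> uedges (subdivision_graph G)" "v \<in> s"
    then show "?f (Inl v) \<noteq> ?f (Inr s)"
      using f_edge[of s] by (cases v) (auto simp: f_old f_new)
  qed
  \<comment> \<open>Every arc joins an old vertex to a new one, so colour 0 tells the two colour
    sets apart.\<close>
  moreover have "0 \<in> color_set (subdivision_graph G) ?f (Inl x)"
    and "0 \<notin> color_set (subdivision_graph G) ?f (Inr e)" for x e
    using f_edge by (auto simp: color_set_def f_old f_new) (metis zero_neq_numeral)
  then have "\<forall>(u, v) \<in> parcs (subdivision_graph G).
      color_set (subdivision_graph G) ?f u \<noteq> color_set (subdivision_graph G) ?f v"
    by (fastforce simp: subdivision_graph_def)
  ultimately show ?thesis by (simp add: avd_total_coloring_def)
qed

lemma card_subdivision_coloring_le: "card (subdivision_coloring R ` A) \<le> 4"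
proof -
  have "subdivision_coloring R x \<in> {0, 1, 2, 3}" for x
    by (simp add: subdivision_coloring_def split: sum.splits)
  then have "subdivision_coloring R ` A \<subseteq> {0, 1, 2, 3}" by (rule image_subsetI)
  then have "card (subdivision_coloring R ` A) \<le> card {0, 1, 2, 3 :: nat}"
    by (intro card_mono) simp_all
  then show ?thesis by simp
qed

text \<open>When \<open>ab\<close> is an edge, the elements of the path from \<open>a\<close>
  through the new vertex to \<open>b\<close> receive 0, 1, 2, 0, 1 in this order. Colour 2 is seen
  at the new vertex only.\<close>

lemma avd_total_coloring_single_edge_subdivision:
  assumes "pverts G = {a, b}" "a \<noteq> b"
  shows "\<exists>f :: ('a + 'a set) + ('a + 'a set) set \<Rightarrow> nat.
    avd_total_coloring (subdivision_graph G) f \<and>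
    card (f ` total_elements (subdivision_graph G)) \<le> 3"
proof -
  let ?S = "subdivision_graph G"
  define f :: "('a + 'a set) + ('a + 'a set) set \<Rightarrow> nat" where
    "f = case_sum (case_sum (\<lambda>x. if x = a then 0 else 1) (\<lambda>_. 2))
      (\<lambda>s. if Inl a \<in> s then 1 else 0)"
  have E: "e \<in> uedges G \<Longrightarrow> e = {a, b}" for e
    using uedges_subset[of e] assms by (auto elim!: uedgeE)
  have "proper_total_coloring ?S f"
    unfolding proper_total_coloring_def uedges_subdivision_graph
    using \<open>a \<noteq> b\<close> by (auto simp: subdivision_graph_def f_def dest!: E)
  moreover have "2 \<notin> color_set ?S f (Inl x)" "2 \<in> color_set ?S f (Inr e)" for x e
    by (auto simp: color_set_def f_def)
  then have "\<forall>(u, v) \<in> parcs ?S. color_set ?S f u \<noteq> color_set ?S f v"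
    by (fastforce simp: subdivision_graph_def)
  moreover have "f x \<in> {0, 1, 2}" for x by (simp add: f_def split: sum.splits)
  then have "f ` total_elements ?S \<subseteq> {0, 1, 2}" by (rule image_subsetI)
  then have "card (f ` total_elements ?S) \<le> card {0, 1, 2 :: nat}"
    by (intro card_mono) simp_all
  then have "card (f ` total_elements ?S) \<le> 3" by simp
  ultimately show ?thesis unfolding avd_total_coloring_def by blast
qed

section \<open>Connectivity and the recognition of \<open>path_graph 2\<close>\<close>

text \<open>If no arc left \<open>A\<close>, then \<open>A\<close> would be closed under
  reachability. Connectivity together with symmetry makes every vertex reachable from a point of
  \<open>A\<close>.\<close>

lemma connected_arc_leaving:
  assumes con: "Digraph_Component.connected (with_proj G)"
    and A: "A \<subset> pverts G" "A \<noteq> {}"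
  shows "\<exists>u v. (u, v) \<in> parcs G \<and> u \<in> A \<and> v \<notin> A"
proof (rule ccontr)
  assume closed: "\<not> ?thesis"
  obtain a b where a: "a \<in> A" and b: "b \<in> pverts G" "b \<notin> A" using A by blast
  have "strongly_connected (with_proj G)"
    using con symmetric_connected_imp_strongly_connected sym_arcs by blast
  then have "a \<rightarrow>\<^sup>*\<^bsub>with_proj G\<^esub> b"
    using a b A by (auto simp: strongly_connected_def)
  then have "b \<in> A"
    using a closed by (induction rule: reachable_induct) auto
  then show False using b by simp
qed

lemma digraph_iso_path_graph_2:
  assumes G: "pverts G = {a, b}" "a \<noteq> b" "(a, b) \<in> parcs G"
  shows "digraph_iso (with_proj G) (with_proj (path_graph 2))"
proof -
  have "p \<in> {(a, b), (b, a)}" if "p \<in> parcs G" for p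
  proof (cases p)
    case (Pair x y)
    then have "x \<in> {a, b}" "y \<in> {a, b}" "x \<noteq> y"
      using that G(1) in_arcsD1[of x y] in_arcsD2[of x y] no_loops[of p] by auto
    then show ?thesis using Pair by auto
  qed
  then have arcs: "parcs G = {(a, b), (b, a)}" using G arcs_symmetric by blast
  \<comment> \<open>The isomorphism sends \<open>a\<close> to 0 and \<open>b\<close> to 1, and acts
    on arcs componentwise.\<close>
  define h where "h x = (if x = a then 0 else 1 :: nat)" for x
  define iso where "iso = \<lparr>iso_verts = h, iso_arcs = map_prod h h, iso_head = snd, iso_tail = fst\<rparr>"
  have "pre_digraph.digraph_isomorphism (with_proj G) iso"
    unfolding pre_digraph.digraph_isomorphism_def using \<open>a \<noteq> b\<close> wf_digraph_axioms
    by (auto simp: iso_def h_def G(1) arcs inj_on_def)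
  moreover have "pverts (path_graph 2) = {0, 1}" "parcs (path_graph 2) = {(0, 1), (1, 0)}"
    by (auto simp: path_graph_def)
  then have "with_proj (path_graph 2) = app_iso iso (with_proj G)"
    using \<open>a \<noteq> b\<close>
    by (intro pre_digraph.equality) (simp_all add: app_iso_def iso_def h_def G(1) arcs insert_commute)
  ultimately show ?thesis unfolding digraph_iso_def by blast
qed

lemma card_verts_digraph_iso_path_graph_2:
  assumes "digraph_iso (with_proj G) (with_proj (path_graph 2))"
  shows "card (pverts G) = 2"
proof -
  obtain iso where iso: "pre_digraph.digraph_isomorphism (with_proj G) iso"
      "with_proj (path_graph 2) = app_iso iso (with_proj G)"
    using assms unfolding digraph_iso_def by blast
  have "{..<2} = iso_verts iso ` pverts G"
    using arg_cong[OF iso(2), of verts] by (simp add: app_iso_def path_graph_def)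
  moreover have "inj_on (iso_verts iso) (pverts G)"
    using iso(1) by (simp add: pre_digraph.digraph_isomorphism_def)
  ultimately show ?thesis by (metis card_image card_lessThan)
qed

text \<open>An arc leaving \<open>{a}\<close> yields a neighbour \<open>b\<close>. As
  \<open>G\<close> is not the path on two vertices, \<open>{a, b}\<close> is not everything, and an
  arc leaving it gives \<open>a\<close> or \<open>b\<close> a second neighbour.\<close>

lemma ex_vertex_two_neighbours:
  assumes con: "Digraph_Component.connected (with_proj G)" and "card (pverts G) \<ge> 2"
    and "\<not> digraph_iso (with_proj G) (with_proj (path_graph 2))"
  shows "\<exists>x y z. (x, y) \<in> parcs G \<and> (x, z) \<in> parcs G \<and> y \<noteq> z"
proof -
  have nonempty: "pverts G \<noteq> {}" and single: "pverts G \<noteq> {a}" for a using assms(2) by auto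
  then obtain a where "a \<in> pverts G" by blast
  then have "{a} \<subset> pverts G" using single by blast
  then obtain b where ab: "(a, b) \<in> parcs G" "a \<noteq> b"
    using connected_arc_leaving[OF con, of "{a}"] by auto
  then have "{a, b} \<noteq> pverts G" using digraph_iso_path_graph_2 assms(3) by metis
  then have "{a, b} \<subset> pverts G" using in_arcsD1[OF ab(1)] in_arcsD2[OF ab(1)] by blast
  then obtain u v where "(u, v) \<in> parcs G" "u \<in> {a, b}" "v \<notin> {a, b}"
    using connected_arc_leaving[OF con, of "{a, b}"] by blast
  moreover have "(b, a) \<in> parcs G" using ab arcs_symmetric by blast
  ultimately show ?thesis using ab by blast
qed

end

section \<open>The AVD-total chromatic number of the subdivision graph\<close>

theorem proposition2p5:
  fixes G :: "'a pair_pre_digraph"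
  assumes "pair_graph G"
    and "Digraph_Component.connected (with_proj G)"
    and "card (pverts G) \<ge> 2"
    and "max_degree G \<le> 2"
  shows "avd_total_chromatic_number (subdivision_graph G) =
    (if digraph_iso (with_proj G) (with_proj (path_graph 2)) then 3 else 4)"
proof -
  interpret pair_graph G by fact
  interpret S: pair_graph "subdivision_graph G" by (rule pair_graph_subdivision_graph)
  have arcs: "(Inl x, Inr {x, y}) \<in> parcs (subdivision_graph G)"
      "(Inr {x, y}, Inl x) \<in> parcs (subdivision_graph G)"
      "(Inr {x, y}, Inl y) \<in> parcs (subdivision_graph G)" "x \<noteq> y"
    if "(x, y) \<in> parcs G" for x y
    using subdivision_graph_arcs[OF arc_uedge[OF that]] pair_no_loops[OF that] by simp_all
  show ?thesis
  proof (cases "digraph_iso (with_proj G) (with_proj (path_graph 2))")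
    case True
    then obtain a b where ab: "pverts G = {a, b}" "a \<noteq> b"
      using card_verts_digraph_iso_path_graph_2 by (auto simp: card_2_iff)
    then have "{a} \<subset> pverts G" by auto
    then have "(a, b) \<in> parcs G"
      using connected_arc_leaving[OF assms(2), of "{a}"] ab in_arcsD2 by fastforce
    \<comment> \<open>The new vertex has the two neighbours \<open>a\<close> and \<open>b\<close>,
      which forces three colours at it.\<close>
    from arcs[OF this] have "3 \<le> card (f ` total_elements (subdivision_graph G))"
      if "avd_total_coloring (subdivision_graph G) f"
      for f :: "('a + 'a set) + ('a + 'a set) set \<Rightarrow> nat"
      using that S.card_colors_ge_3[of f "Inr {a, b}" "Inl a" "Inl b"]
      by (simp add: avd_total_coloring_def)
    then show ?thesis
      using avd_total_coloring_single_edge_subdivision[OF ab] True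
        S.avd_total_chromatic_number_eqI by (metis (no_types, lifting))
  next
    case False
    obtain x y z where xyz: "(x, y) \<in> parcs G" "(x, z) \<in> parcs G" "y \<noteq> z"
      using ex_vertex_two_neighbours[OF assms(2,3) False] by blast
    have "{x, y} \<noteq> {x, z}" using xyz(3) by (auto simp: doubleton_eq_iff)
    \<comment> \<open>The adjacent vertices are the old \<open>x\<close> and the new
      \<open>{x, y}\<close>. Their further neighbours are the new \<open>{x, z}\<close> and the old
      \<open>y\<close>.\<close>
    then have lower: "4 \<le> card (f ` total_elements (subdivision_graph G))"
      if "avd_total_coloring (subdivision_graph G) f"
      for f :: "('a + 'a set) + ('a + 'a set) set \<Rightarrow> nat"
      using S.card_colors_ge_4[OF that, of "Inl x" "Inr {x, y}" "Inr {x, z}" "Inl y"]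
        arcs[OF xyz(1)] arcs[OF xyz(2)] by auto
    have "card e = 2" if "e \<in> uedges G" for e using that by (auto elim!: uedgeE)
    moreover have "card {e \<in> uedges G. v \<in> e} \<le> 2" for v
      using card_neighbours_le_max_degree[of v] assms(4) by (simp add: card_uedges_at)
    ultimately obtain R where "orients R (uedges G)"
      using ex_orientation[OF finite_uedges] by blast
    then show ?thesis
      using S.avd_total_chromatic_number_eqI[OF avd_subdivision_coloring
          card_subdivision_coloring_le lower] False by simp
  qed
qed

end
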